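(* The graph $\mathrm{ZT}(\mathbb{Z}_m)$ is acyclic if $m$ is equal to $2^2$, $3^2$, $2^3$, $m=2^2p$ or $m=pq$, for any distinct prime numbers $p,q$. Otherwise, the girth of $\mathrm{ZT}(\mathbb{Z}_m)$ is equal to $3$.
   Context: $\mathbb{Z}_m$ is the ring of integers modulo $m$, and $Z(\mathbb{Z}_m)$ is its set of zero-divisors, with $0$ included. The total zero-divisor graph $\mathrm{ZT}(\mathbb{Z}_m)$ is the simple graph whose vertices are the nonzero zero-divisors of $\mathbb{Z}_m$, with distinct vertices $u,v$ adjacent if and only if $uv=0$ and $u+v\in Z(\mathbb{Z}_m)$. The girth of a graph is the length of its shortest cycle; a graph is acyclic if it contains no cycle.
   Formalization: The modulus m is assumed to be greater than 1 and not prime: for prime m (e.g. m = 5) or m ≤ 1 the graph has no vertices, so it has no cycle and the claim "otherwise the girth is 3" fails; no listed value of m is excluded. *)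

theory Defs
  imports
    "HOL-Number_Theory.Residues"
    "HOL-Library.Extended_Nat"
    "Graph_Theory.Pair_Digraph"
begin

definition zero_divisors :: "('a, 'b) ring_scheme \<Rightarrow> 'a set" where
  "zero_divisors R =
     {a \<in> carrier R. a = \<zero>\<^bsub>R\<^esub> \<or> (\<exists>b \<in> carrier R. b \<noteq> \<zero>\<^bsub>R\<^esub> \<and> a \<otimes>\<^bsub>R\<^esub> b = \<zero>\<^bsub>R\<^esub>)}"

text \<open>A simple graph is represented by the library's \<open>pair_graph\<close>: every undirected edge
  \<open>{u, v}\<close> is the pair of arcs \<open>(u, v)\<close> and \<open>(v, u)\<close>.\<close>

definition ZT :: "('a, 'b) ring_scheme \<Rightarrow> 'a pair_pre_digraph" where
  "ZT R =
     \<lparr> pverts = zero_divisors R - {\<zero>\<^bsub>R\<^esub>},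
       parcs = {(u, v). u \<in> zero_divisors R - {\<zero>\<^bsub>R\<^esub>} \<and> v \<in> zero_divisors R - {\<zero>\<^bsub>R\<^esub>} \<and>
                 u \<noteq> v \<and> u \<otimes>\<^bsub>R\<^esub> v = \<zero>\<^bsub>R\<^esub> \<and> u \<oplus>\<^bsub>R\<^esub> v \<in> zero_divisors R} \<rparr>"

text \<open>The library's \<open>cycle\<close> is a directed notion and also accepts the closed walk \<open>u, v, u\<close>
  along the two arcs of a single edge. The cycles of a simple graph are those of length at
  least \<open>3\<close>.\<close>

definition graph_cycle :: "'a pair_pre_digraph \<Rightarrow> ('a \<times> 'a) awalk \<Rightarrow> bool" where
  "graph_cycle G p \<longleftrightarrow> pre_digraph.cycle (with_proj G) p \<and> 3 \<le> length p"

definition acyclic_graph :: "'a pair_pre_digraph \<Rightarrow> bool" where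
  "acyclic_graph G \<longleftrightarrow> \<not> (\<exists>p. graph_cycle G p)"

text \<open>The girth of an acyclic graph is \<open>\<infinity>\<close>, the infimum of the empty set.\<close>

definition girth :: "'a pair_pre_digraph \<Rightarrow> enat" where
  "girth G = (INF p \<in> {p. graph_cycle G p}. enat (length p))"

lemma pair_graph_ZT:
  assumes "cring R" and "finite (carrier R)"
  shows "pair_graph (ZT R)"
proof -
  interpret cring R by fact
  have sub: "zero_divisors R \<subseteq> carrier R"
    by (auto simp: zero_divisors_def)
  then have fin: "finite (zero_divisors R)"
    using assms(2) finite_subset by blast
  have "parcs (ZT R) \<subseteq> zero_divisors R \<times> zero_divisors R"
    by (auto simp: ZT_def)
  then have "finite (parcs (ZT R))"
    using fin by (meson finite_SigmaI finite_subset)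
  moreover have "sym (parcs (ZT R))"
    using sub by (auto simp: ZT_def sym_def m_comm a_comm subset_iff)
  ultimately show ?thesis
    using fin by unfold_locales (auto simp: ZT_def symmetric_def)
qed

text \<open>For a prime modulus there are no nonzero zero-divisors, so the graph has no vertices.\<close>

lemma pverts_ZT_prime:
  assumes "prime p"
  shows "pverts (ZT (residue_ring (int p))) = {}"
proof -
  interpret residues_prime p "residue_ring (int p)"
    using assms by unfold_locales simp_all
  interpret field "residue_ring (int p)" by (rule is_field)
  show ?thesis
    using integral by (fastforce simp: ZT_def zero_divisors_def)
qed

end

theory Submission
  imports Defs
begin

text \<open>
  Over \<open>residue_ring m\<close> everything becomes divisibility of integers: distinct \<open>u, v\<close> in
  \<open>{0<..<m}\<close> are adjacent iff \<open>m\<close> divides \<open>u * v\<close> and \<open>u + v\<close> shares a factor with \<open>m\<close>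
  (\<open>arc_ZT_residue_ring_iff\<close>). For the exceptional moduli all edges pass through a single
  vertex: there are none at all for \<open>m = 4\<close> and \<open>m = p * q\<close>, only one for \<open>m = 9\<close>, and \<open>m = 4 * p\<close>
  gives a star around \<open>2 * p\<close>. A graph whose edges share a vertex has no cycle.

  For the other moduli a triangle is written down. If \<open>m = a * b * c\<close> with distinct
  \<open>a, b, c > 1\<close>, take \<open>a * b, b * c, c * a\<close>: each product of two is a multiple of \<open>m\<close>, and two
  of them share one of the factors of \<open>m\<close>. This settles every squarefree \<open>m\<close> with at least three
  prime factors. If \<open>m = d\<^sup>2 * k\<close>, any two distinct nonzero multiples of \<open>d * k\<close> are
  adjacent, and there are \<open>d - 1\<close> of them, which is enough as soon as \<open>d \<ge> 4\<close>. Only \<open>d = 3\<close> and \<open>d = 2\<close> remain,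
  where the multiples of \<open>d * k\<close> have to be completed by other vertices.
\<close>

section \<open>Stars and triangles\<close>

text \<open>Three consecutive edges of a cycle of length at least three have no common vertex: the first
  two meet only in the vertex between them, and the third misses that vertex.\<close>

lemma acyclic_graph_if_arcs_share_vertex:
  assumes "\<And>u v. (u, v) \<in> parcs G \<Longrightarrow> u = c \<or> v = c"
  shows "acyclic_graph G"
proof -
  have False if cyc: "pre_digraph.cycle (with_proj G) p" and len: "3 \<le> length p" for p
  proof -
    obtain e1 e2 e3 es where p: "p = e1 # e2 # e3 # es"
      using len by (auto simp: numeral_3_eq_3 Suc_le_length_iff)
    obtain u where aw: "pre_digraph.awalk (with_proj G) u p u"
      and dist: "distinct (tl (pre_digraph.awalk_verts (with_proj G) u p))"
      using cyc by (auto simp: pre_digraph.cycle_def)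
    have arcs: "set p \<subseteq> parcs G" and cas: "pre_digraph.cas (with_proj G) u p u"
      using aw by (auto simp: pre_digraph.awalk_def)
    obtain x y z where e: "e1 = (u, x)" "e2 = (x, y)" "e3 = (y, z)"
      and cas': "pre_digraph.cas (with_proj G) z es u"
      using cas p by (cases e1; cases e2; cases e3) (auto simp: pre_digraph.cas.simps)
    have verts: "distinct (x # y # pre_digraph.awalk_verts (with_proj G) z es)"
      using dist
      by (cases es) (auto simp: p e pre_digraph.awalk_verts.simps)
    have ends: "z \<in> set (pre_digraph.awalk_verts (with_proj G) z es)"
      "u \<in> set (pre_digraph.awalk_verts (with_proj G) z es)"
      using cas'
      by (induction es arbitrary: z)
         (auto simp: pre_digraph.awalk_verts.simps pre_digraph.cas.simps)
    have "x \<noteq> y" "z \<noteq> x" "z \<noteq> y" "u \<noteq> x" "u \<noteq> y"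
      using verts ends by auto
    moreover have "u = c \<or> x = c" "x = c \<or> y = c" "y = c \<or> z = c"
      using assms arcs p e by auto
    ultimately show False
      by auto
  qed
  then show ?thesis
    by (auto simp: acyclic_graph_def graph_cycle_def)
qed

lemma girth_eq_3_if_triangle:
  assumes arcs: "(u, v) \<in> parcs G" "(v, w) \<in> parcs G" "(w, u) \<in> parcs G"
    and distinct: "u \<noteq> v" "v \<noteq> w" "u \<noteq> w"
    and vertex: "u \<in> pverts G"
  shows "girth G = 3"
proof -
  have "graph_cycle G [(u, v), (v, w), (w, u)]"
    unfolding graph_cycle_def pre_digraph.cycle_def
    using assms
    by (auto intro!: exI[of _ u] simp: pre_digraph.awalk_def pre_digraph.cas.simps
        pre_digraph.awalk_verts.simps)
  then have "girth G \<le> enat (length [(u, v), (v, w), (w, u)])"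
    unfolding girth_def by (intro INF_lower) simp
  moreover have "enat 3 \<le> girth G"
    unfolding girth_def by (intro INF_greatest) (auto simp: graph_cycle_def)
  ultimately show ?thesis
    by (simp add: numeral_eq_enat numeral_3_eq_3)
qed

section \<open>Adjacency in terms of divisibility\<close>

lemma zero_divisors_residue_ring:
  fixes m :: int
  assumes "m > 1"
  shows "zero_divisors (residue_ring m) = {a \<in> {0..<m}. \<not> coprime a m}"
proof -
  have "a = 0 \<or> (\<exists>b\<in>{0..m - 1}. b \<noteq> 0 \<and> m dvd a * b) \<longleftrightarrow> \<not> coprime a m"
    if "0 \<le> a" "a < m" for a
  proof (intro iffI)
    assume "a = 0 \<or> (\<exists>b\<in>{0..m - 1}. b \<noteq> 0 \<and> m dvd a * b)"
    then show "\<not> coprime a m"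
    proof
      assume "a = 0"
      then show ?thesis
        using assms by simp
    next
      assume "\<exists>b\<in>{0..m - 1}. b \<noteq> 0 \<and> m dvd a * b"
      then obtain b where b: "0 < b" "b < m" "m dvd a * b"
        by force
      then have "\<not> m dvd b"
        using zdvd_not_zless by blast
      then show ?thesis
        using b by (metis coprime_commute coprime_dvd_mult_right_iff)
    qed
  next
    assume ncop: "\<not> coprime a m"
    define g where "g = gcd a m"
    obtain b where m: "m = g * b"
      unfolding g_def using gcd_dvd2[of a m] by (elim dvdE)
    obtain a' where a: "a = g * a'"
      unfolding g_def using gcd_dvd1[of a m] by (elim dvdE)
    have "g \<noteq> 1" "g > 0"
      using ncop assms by (simp_all add: g_def coprime_iff_gcd_eq_1 gcd_pos_int)
    then have "g > 1"
      by simp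
    moreover have "b > 0"
      using m assms \<open>g > 1\<close> zero_less_mult_iff[of g b] by linarith
    ultimately have "b < m"
      by (simp add: m)
    moreover have "m dvd a * b"
      by (simp add: a m)
    ultimately show "a = 0 \<or> (\<exists>b\<in>{0..m - 1}. b \<noteq> 0 \<and> m dvd a * b)"
      using \<open>b > 0\<close> by (intro disjI2 bexI[of _ b]) auto
  qed
  then have "{a \<in> {0..m - 1}. a = 0 \<or> (\<exists>b\<in>{0..m - 1}. b \<noteq> 0 \<and> m dvd a * b)}
      = {a \<in> {0..<m}. \<not> coprime a m}"
    by (intro Collect_cong conj_cong) auto
  then show ?thesis
    by (simp add: zero_divisors_def residue_ring_def mod_eq_0_iff_dvd)
qed

text \<open>The endpoints are zero divisors because each annihilates the other one, which is nonzero.\<close>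

lemma arc_ZT_residue_ring_iff:
  fixes m :: int
  assumes "m > 1"
  shows "(u, v) \<in> parcs (ZT (residue_ring m)) \<longleftrightarrow>
    0 < u \<and> u < m \<and> 0 < v \<and> v < m \<and> u \<noteq> v \<and> m dvd u * v \<and> \<not> coprime (u + v) m"
proof -
  have "\<not> coprime u m" "\<not> coprime v m"
    if "0 < u" "u < m" "0 < v" "v < m" "m dvd u * v"
    using that zdvd_not_zless[of u m] zdvd_not_zless[of v m]
    by (metis coprime_commute coprime_dvd_mult_right_iff coprime_dvd_mult_left_iff)+
  moreover have "coprime ((u + v) mod m) m \<longleftrightarrow> coprime (u + v) m"
    using assms by (simp add: coprime_mod_left_iff)
  moreover have "0 \<le> (u + v) mod m" "(u + v) mod m < m"
    using assms by simp_all
  ultimately show ?thesis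
    unfolding ZT_def zero_divisors_residue_ring[OF assms]
    by (auto simp: residue_ring_def mod_eq_0_iff_dvd)
qed

text \<open>In every triangle used below, the sums are zero divisors because the three vertices pairwise
  share factors with \<open>m\<close>.\<close>

lemma girth_ZT_residue_ring_eq_3:
  fixes m u v w :: int
  assumes range: "{u, v, w} \<subseteq> {0<..<m}"
    and distinct: "u \<noteq> v" "v \<noteq> w" "u \<noteq> w"
    and products: "m dvd u * v" "m dvd v * w" "m dvd u * w"
    and common: "d dvd u" "d dvd v" "d dvd m" "\<bar>d\<bar> \<noteq> 1"
      "e dvd v" "e dvd w" "e dvd m" "\<bar>e\<bar> \<noteq> 1"
      "f dvd u" "f dvd w" "f dvd m" "\<bar>f\<bar> \<noteq> 1"
  shows "girth (ZT (residue_ring m)) = 3"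
proof -
  have m: "m > 1"
    using range by auto
  have ncop: "\<not> coprime (x + y) m" if "g dvd x" "g dvd y" "g dvd m" "\<bar>g\<bar> \<noteq> 1" for g x y :: int
    using that by (metis coprime_common_divisor dvd_add zdvd1_eq)
  have arcs: "(u, v) \<in> parcs (ZT (residue_ring m))" "(v, w) \<in> parcs (ZT (residue_ring m))"
    "(w, u) \<in> parcs (ZT (residue_ring m))"
    unfolding arc_ZT_residue_ring_iff[OF m]
    using range distinct products ncop[of d u v] ncop[of e v w] ncop[of f w u] common
    by (auto simp: mult.commute)
  then have "u \<in> pverts (ZT (residue_ring m))"
    by (auto simp: ZT_def)
  with arcs distinct show ?thesis
    by (intro girth_eq_3_if_triangle)
qed

section \<open>The exceptional moduli\<close>

text \<open>If \<open>u * v\<close> is a multiple of \<open>p * q\<close>, then one end is divisible by \<open>p\<close> only and the other by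
  \<open>q\<close> only, so their sum is coprime to both primes.\<close>

lemma acyclic_ZT_product_of_distinct_primes:
  fixes p q :: int
  assumes "prime p" "prime q" "p \<noteq> q"
  shows "acyclic_graph (ZT (residue_ring (p * q)))"
proof (rule acyclic_graph_if_arcs_share_vertex)
  fix u v c :: int
  have m: "p * q > 1"
    using assms by (meson less_1_mult prime_gt_1_int)
  have cop: "coprime p q"
    using assms by (simp add: primes_coprime)
  assume "(u, v) \<in> parcs (ZT (residue_ring (p * q)))"
  then have u: "0 < u" "u < p * q" and v: "0 < v" "v < p * q"
    and dvd: "p * q dvd u * v" and ncop: "\<not> coprime (u + v) (p * q)"
    unfolding arc_ZT_residue_ring_iff[OF m] by auto
  have nu: "\<not> (p dvd u \<and> q dvd u)" and nv: "\<not> (p dvd v \<and> q dvd v)"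
    using u v cop divides_mult zdvd_not_zless by blast+
  have "p dvd u * v" "q dvd u * v"
    using dvd dvd_mult_left dvd_mult_right by blast+
  then have "p dvd u \<or> p dvd v" "q dvd u \<or> q dvd v"
    using assms by (simp_all add: prime_dvd_mult_iff)
  moreover have "p dvd u + v \<or> q dvd u + v"
    using ncop assms by (metis coprime_commute coprime_mult_left_iff prime_imp_coprime)
  ultimately have False
    using nu nv by (metis dvd_add_right_iff dvd_add_left_iff)
  \<comment> \<open>There are no edges at all, so any vertex serves as the centre.\<close>
  then show "u = c \<or> v = c" ..
qed

text \<open>For odd \<open>p\<close> an edge has an end divisible by \<open>p\<close>. If the other end is not, then the common
  factor of the sum and \<open>4 * p\<close> is even; as the product of the ends is even too, both ends are even
  and the first one is \<open>2 * p\<close>.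
  If both are multiples of \<open>p\<close>, only \<open>p, 2 * p, 3 * p\<close> are possible, and \<open>p * (3 * p)\<close> is odd.\<close>

lemma acyclic_ZT_four_times_odd_prime:
  fixes p :: int
  assumes p: "prime p" "odd p"
  shows "acyclic_graph (ZT (residue_ring (4 * p)))"
proof (rule acyclic_graph_if_arcs_share_vertex)
  have p0: "p > 1"
    using p by (simp add: prime_gt_1_int)
  then have m: "4 * p > 1"
    by simp
  have centre: "x = 2 * p \<or> y = 2 * p"
    if x: "0 < x" "x < 4 * p" "p dvd x" and y: "0 < y" "y < 4 * p"
      and dvd: "4 * p dvd x * y" and ncop: "\<not> coprime (x + y) (4 * p)" for x y :: int
  proof -
    obtain a where a: "x = p * a"
      using x by auto
    have a_range: "a = 1 \<or> a = 2 \<or> a = 3"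
      using x p0 by (auto simp: a zero_less_mult_iff)
    have "even (x * y)"
      using dvd by (meson dvd_mult_left dvd_trans even_numeral)
    show ?thesis
    proof (cases "p dvd y")
      case True
      then obtain b where b: "y = p * b"
        by auto
      have b_range: "b = 1 \<or> b = 2 \<or> b = 3"
        using y p0 by (auto simp: b zero_less_mult_iff)
      have "even (a * b)"
        using \<open>even (x * y)\<close> p by (simp add: a b)
      then show ?thesis
        using a_range b_range by (auto simp: a b)
    next
      case False
      then have "\<not> p dvd x + y"
        using x by (simp add: dvd_add_right_iff)
      then have "coprime (x + y) p"
        using p by (metis coprime_commute prime_imp_coprime)
      then have "\<not> coprime (x + y) (2 * 2)"
        using ncop by (simp add: coprime_mult_right_iff)
      then have "even (x + y)"
        unfolding coprime_mult_right_iff by (simp add: coprime_right_2_iff_odd)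
      then have "even x"
        using \<open>even (x * y)\<close> by auto
      then have "even a"
        using p by (simp add: a)
      then show ?thesis
        using a_range by (auto simp: a)
    qed
  qed
  fix u v :: int
  assume "(u, v) \<in> parcs (ZT (residue_ring (4 * p)))"
  then have arc: "0 < u" "u < 4 * p" "0 < v" "v < 4 * p" "4 * p dvd u * v"
    "\<not> coprime (u + v) (4 * p)"
    unfolding arc_ZT_residue_ring_iff[OF m] by auto
  have "p dvd u \<or> p dvd v"
    using arc(5) p by (metis dvd_mult_right prime_dvd_mult_iff)
  then show "u = 2 * p \<or> v = 2 * p"
    using centre[of u v] centre[of v u] arc by (auto simp: ac_simps)
qed

lemma acyclic_ZT_4: "acyclic_graph (ZT (residue_ring 4))"
proof (rule acyclic_graph_if_arcs_share_vertex)
  fix u v :: int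
  assume "(u, v) \<in> parcs (ZT (residue_ring 4))"
  then have "0 < u" "u < 4" "0 < v" "v < 4" "4 dvd u * v"
    by (auto simp: arc_ZT_residue_ring_iff)
  moreover from this have "u \<in> {1, 2, 3}" "v \<in> {1, 2, 3}"
    by auto
  ultimately show "u = 2 \<or> v = 2"
    by auto
qed

lemma acyclic_ZT_8: "acyclic_graph (ZT (residue_ring 8))"
proof (rule acyclic_graph_if_arcs_share_vertex)
  fix u v :: int
  assume "(u, v) \<in> parcs (ZT (residue_ring 8))"
  then have "0 < u" "u < 8" "0 < v" "v < 8" "8 dvd u * v"
    by (auto simp: arc_ZT_residue_ring_iff)
  moreover from this have "u \<in> {1, 2, 3, 4, 5, 6, 7}" "v \<in> {1, 2, 3, 4, 5, 6, 7}"
    by auto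
  ultimately show "u = 4 \<or> v = 4"
    by auto
qed

lemma acyclic_ZT_9: "acyclic_graph (ZT (residue_ring 9))"
proof (rule acyclic_graph_if_arcs_share_vertex)
  fix u v :: int
  assume "(u, v) \<in> parcs (ZT (residue_ring 9))"
  then have "0 < u" "u < 9" "0 < v" "v < 9" "u \<noteq> v" "9 dvd u * v"
    by (auto simp: arc_ZT_residue_ring_iff)
  moreover from this have "u \<in> {1, 2, 3, 4, 5, 6, 7, 8}" "v \<in> {1, 2, 3, 4, 5, 6, 7, 8}"
    by auto
  ultimately show "u = 3 \<or> v = 3"
    by auto
qed

section \<open>Triangles for the other moduli\<close>

lemma girth_ZT_three_distinct_factors:
  fixes a b c :: int
  assumes "a > 1" "b > 1" "c > 1" "a \<noteq> b" "b \<noteq> c" "a \<noteq> c"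
  shows "girth (ZT (residue_ring (a * b * c))) = 3"
proof (rule girth_ZT_residue_ring_eq_3[where u = "a * b" and v = "b * c" and w = "c * a"
      and d = b and e = c and f = a])
  have "a * b * 1 < a * b * c" "b * c * 1 < b * c * a" "c * a * 1 < c * a * b"
    using assms by (intro mult_strict_left_mono; simp)+
  then show "{a * b, b * c, c * a} \<subseteq> {0<..<a * b * c}"
    using assms by (auto simp: ac_simps)
  have "a * b * (b * c) = a * b * c * b" "b * c * (c * a) = a * b * c * c"
    "a * b * (c * a) = a * b * c * a"
    by (simp_all add: ac_simps)
  then show "a * b * c dvd a * b * (b * c)" "a * b * c dvd b * c * (c * a)"
    "a * b * c dvd a * b * (c * a)"
    by (metis dvd_triv_left)+
qed (use assms in auto)

lemma girth_ZT_square_factor_ge_4: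
  fixes d k :: int
  assumes "d \<ge> 4" "k > 0"
  shows "girth (ZT (residue_ring (d\<^sup>2 * k))) = 3"
proof (rule girth_ZT_residue_ring_eq_3[where u = "d * k" and v = "2 * (d * k)" and w = "3 * (d * k)"
      and d = d and e = d and f = d])
  have pos: "d * k > 0"
    using assms by simp
  then have "4 * (d * k) \<le> d * (d * k)"
    using assms by (intro mult_right_mono) auto
  with pos show "{d * k, 2 * (d * k), 3 * (d * k)} \<subseteq> {0<..<d\<^sup>2 * k}"
    by (auto simp: power2_eq_square mult.assoc)
qed (use assms in \<open>auto simp: power2_eq_square\<close>)

text \<open>The nonzero multiples \<open>3 * k\<close> and \<open>6 * k\<close> are adjacent; \<open>3\<close> is adjacent to both, and it is a
  third vertex since \<open>k > 1\<close>.\<close>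

lemma girth_ZT_nine_times:
  fixes k :: int
  assumes "k > 1"
  shows "girth (ZT (residue_ring (9 * k))) = 3"
proof (rule girth_ZT_residue_ring_eq_3[where u = 3 and v = "3 * k" and w = "6 * k"
      and d = 3 and e = 3 and f = 3])
  show "9 * k dvd 3 * k * (6 * k)" "9 * k dvd 3 * (6 * k)"
    by (auto intro: dvdI[of _ _ "2 * k"] dvdI[of _ _ 2])
qed (use assms in \<open>auto intro: dvd_trans[of 3 9] dvd_trans[of 3 6]\<close>)

text \<open>Here \<open>2 * k\<close> annihilates every even number, so the triangle is completed by two even numbers with
  product \<open>4 * k\<close>, namely \<open>2 * a\<close> and \<open>2 * b\<close> for \<open>k = a * b\<close>; when \<open>a = b\<close> they coincide, but then
  \<open>4 * k\<close> is the square of \<open>2 * a\<close>.\<close>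

lemma girth_ZT_four_times_composite:
  fixes a b :: int
  assumes "a > 1" "b > 1"
  shows "girth (ZT (residue_ring (4 * (a * b)))) = 3"
proof (cases "a = b")
  case True
  then show ?thesis
    using girth_ZT_square_factor_ge_4[of "2 * a" 1] assms by (simp add: power2_eq_square)
next
  case False
  have "a * 1 < a * b" "b * 1 < b * a"
    using assms by (intro mult_strict_left_mono; simp)+
  then have lt: "a < a * b" "b < a * b"
    by (simp_all add: mult.commute)
  show ?thesis
  proof (rule girth_ZT_residue_ring_eq_3[where u = "2 * a" and v = "2 * b" and w = "2 * (a * b)"
        and d = 2 and e = 2 and f = 2])
    show "{2 * a, 2 * b, 2 * (a * b)} \<subseteq> {0<..<4 * (a * b)}"
      using lt assms by auto
  qed (use False lt in auto)
qed

section \<open>The classification\<close>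

lemma composite_nat_factors:
  fixes n :: nat
  assumes "n > 1" "\<not> prime n"
  obtains p k where "prime p" "k > 1" "n = p * k"
proof -
  obtain p where p: "prime p" "p dvd n"
    using assms prime_factor_nat[of n] by auto
  then obtain k where k: "n = p * k"
    by auto
  have "k \<noteq> 0" "k \<noteq> 1"
    using assms p k by auto
  then have "k > 1"
    by simp
  with p k that show thesis
    by blast
qed

text \<open>Splitting off two primes leaves a third factor greater than \<open>1\<close>. It may be composite: being
  distinct from the two primes is all that the triangle asks for.\<close>

lemma girth_ZT_squarefree:
  fixes m :: nat
  assumes m: "m > 1" "\<not> prime m"
    and squarefree: "\<And>d. d\<^sup>2 dvd m \<Longrightarrow> d < 2"
    and not_pq: "\<nexists>p q. prime p \<and> prime q \<and> p \<noteq> q \<and> m = p * q"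
  shows "girth (ZT (residue_ring (int m))) = 3"
proof -
  obtain p n where p: "prime p" "n > 1" "m = p * n"
    using composite_nat_factors m by blast
  have factors_distinct: "x \<noteq> y" if "m = x * y * z" "x > 1" for x y z
    using that squarefree[of x] by (auto simp: power2_eq_square)
  have "p \<noteq> n"
    using factors_distinct[of p n 1] p prime_gt_1_nat by auto
  then have "\<not> prime n"
    using not_pq p by auto
  then obtain q r where q: "prime q" "r > 1" "n = q * r"
    using composite_nat_factors p(2) by blast
  have gt: "p > 1" "q > 1"
    using p q prime_gt_1_nat by auto
  have "p \<noteq> q" "p \<noteq> r" "q \<noteq> r"
    using factors_distinct[of p q r] factors_distinct[of p r q] factors_distinct[of q r p] p q gt
    by (auto simp: ac_simps)
  then show ?thesis
    using girth_ZT_three_distinct_factors[of "int p" "int q" "int r"] gt p q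
    by (simp add: mult.assoc)
qed

theorem lemma4p2:
  fixes m :: nat
  assumes "m > 1" and "\<not> prime m"
  shows "if m = 2^2 \<or> m = 3^2 \<or> m = 2^3 \<or> (\<exists>p. prime p \<and> m = 2^2 * p) \<or>
            (\<exists>p q. prime p \<and> prime q \<and> p \<noteq> q \<and> m = p * q)
         then acyclic_graph (ZT (residue_ring (int m)))
         else girth (ZT (residue_ring (int m))) = 3"
    (is "if ?exceptional then ?acyclic else ?girth3")
proof -
  have acyclic_4p: ?acyclic if "prime p" "m = 2^2 * p" for p
  proof (cases "p = 2")
    case True
    then show ?thesis
      using that acyclic_ZT_8 by simp
  next
    case False
    then have "odd p"
      using that(1) primes_dvd_imp_eq two_is_prime_nat by blast
    then show ?thesis
      using that acyclic_ZT_four_times_odd_prime[of "int p"] by simp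
  qed
  have acyclic_pq: ?acyclic if "prime p" "prime q" "p \<noteq> q" "m = p * q" for p q
    using that acyclic_ZT_product_of_distinct_primes[of "int p" "int q"] by simp
  have ?acyclic if ?exceptional
    using that acyclic_ZT_4 acyclic_ZT_8 acyclic_ZT_9 acyclic_4p acyclic_pq
    by (elim disjE exE conjE) simp_all
  moreover have ?girth3 if not_exc: "\<not> ?exceptional"
  proof (cases "\<exists>d\<ge>2. d\<^sup>2 dvd m")
    case True
    then obtain d k where d: "d \<ge> 2" "m = d\<^sup>2 * k"
      by auto
    have k: "k > 0"
      using assms d by (cases k) auto
    consider "d \<ge> 4" | "d = 3" | "d = 2"
      using d(1) by linarith
    then show ?thesis
    proof cases
      case 1
      then show ?thesis
        using girth_ZT_square_factor_ge_4[of "int d" "int k"] d k by simp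
    next
      case 2
      then have "k \<noteq> 1"
        using not_exc d by auto
      then show ?thesis
        using girth_ZT_nine_times[of "int k"] 2 d k by simp
    next
      case 3
      then have "k \<noteq> 1" "\<not> prime k"
        using not_exc d by auto
      then obtain p l where "prime p" "l > 1" "k = p * l"
        using k composite_nat_factors[of k] by (metis less_one linorder_neqE_nat not_gr_zero)
      then show ?thesis
        using girth_ZT_four_times_composite[of "int p" "int l"] prime_gt_1_nat[of p] 3 d by simp
    qed
  next
    case False
    then show ?thesis
      using not_exc assms by (intro girth_ZT_squarefree) (auto simp: not_le)
  qed
  ultimately show ?thesis
    by auto
qed

end
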